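(* Let $k\ge 3$ and $0\le\alpha<1$. Let $G$ be a connected $k$-uniform hypergraph on $n$ vertices with $m$ edges, and let $S$ be a nonempty subset of $V(G)$ with $|S|=s$. Then $$\rho_{\alpha}(G)-\frac{km}{n}\ \ge\ \frac{1}{kn}\left(\alpha\left(s\,\frac{\sum_{i\in S}d_{i}^{\frac{2k-1}{k-1}}}{\sum_{i\in S}d_{i}^{\frac{k}{k-1}}}-\sum_{i\in S}d_{i}\right)+(1-\alpha)k\left(s^{\frac1k}\left(\sum_{i\in S}d_{i}^{\frac{k}{k-1}}\right)^{\frac{k-1}{k}}-\sum_{i\in S}d_{i}\right)\right).$$
   Context: A $k$-uniform hypergraph $G=(V(G),E(G))$ has a finite vertex set $V(G)$ (identified with $[n]=\{1,\dots,n\}$) and an edge set $E(G)$ consisting of distinct $k$-element subsets of $V(G)$; hypergraphs are assumed to have at least one edge. The degree $d_i$ of a vertex $i$ is the number of edges containing $i$. $G$ is connected if every two vertices $u,v$ are joined by a sequence $u=v_1,e_1,v_2,\dots,e_\ell,v_{\ell+1}=v$ with $e_t\in E(G)$ and $\{v_t,v_{t+1}\}\subseteq e_t$. The adjacency tensor $\mathcal{A}(G)$ is the tensor of order $k$ and dimension $n$ with entries $a_{i_1\ldots i_k}=\frac{1}{(k-1)!}$ if $\{i_1,\dots,i_k\}\in E(G)$ and $0$ otherwise; $\mathcal{D}(G)$ is the diagonal tensor of order $k$ and dimension $n$ with diagonal entries $d_{i\ldots i}=d_i$ and all other entries $0$. For $0\le\alpha<1$, $\mathcal{A}_\alpha(G)=\alpha\mathcal{D}(G)+(1-\alpha)\mathcal{A}(G)$.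 For a tensor $\mathcal{T}=(t_{i_1\ldots i_k})$ of order $k$ and dimension $n$ and $x\in\mathbb{C}^n$, $(\mathcal{T}x)_i=\sum_{i_2,\dots,i_k=1}^n t_{ii_2\ldots i_k}x_{i_2}\cdots x_{i_k}$. A number $\lambda\in\mathbb{C}$ is an eigenvalue of $\mathcal{T}$ with eigenvector $0\ne x\in\mathbb{C}^n$ if $(\mathcal{T}x)_i=\lambda x_i^{k-1}$ for all $i$; the spectral radius $\rho(\mathcal{T})$ is the maximum of $|\lambda|$ over eigenvalues $\lambda$ of $\mathcal{T}$. $\rho_\alpha(G)=\rho(\mathcal{A}_\alpha(G))$. *)

theory Defs
  imports "HOL-Analysis.Analysis"
begin

text \<open>
  The vertex set of a hypergraph is the whole of a finite type \<open>'v\<close>, so that \<open>n = CARD('v)\<close>,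
  and a hypergraph is given by its set of edges \<open>E :: 'v set set\<close>.
\<close>

definition uniform_hypergraph :: "nat \<Rightarrow> 'v::finite set set \<Rightarrow> bool" where
  "uniform_hypergraph k E \<longleftrightarrow> E \<noteq> {} \<and> (\<forall>e\<in>E. card e = k)"

definition vertex_degree :: "'v::finite set set \<Rightarrow> 'v \<Rightarrow> nat" where
  "vertex_degree E i = card {e \<in> E. i \<in> e}"

definition connected_hypergraph :: "'v::finite set set \<Rightarrow> bool" where
  "connected_hypergraph E \<longleftrightarrow> (\<forall>u v. (u, v) \<in> {(a, b). \<exists>e\<in>E. {a, b} \<subseteq> e}\<^sup>*)"

text \<open>
  A tensor of order \<open>k\<close> and dimension \<open>CARD('v)\<close> is a function on index lists
  \<open>[i\<^sub>1, \<dots>, i\<^sub>k]\<close>.  The order is passed separately, and only the values on lists of length \<open>k\<close>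
  are ever used.
\<close>

type_synonym 'v tensor = "'v list \<Rightarrow> complex"

definition adjacency_tensor :: "nat \<Rightarrow> 'v::finite set set \<Rightarrow> 'v tensor" where
  "adjacency_tensor k E is = (if set is \<in> E then 1 / fact (k - 1) else 0)"

definition degree_tensor :: "nat \<Rightarrow> 'v::finite set set \<Rightarrow> 'v tensor" where
  "degree_tensor k E is = (if is = replicate k (hd is) then of_nat (vertex_degree E (hd is)) else 0)"

definition A_alpha :: "real \<Rightarrow> nat \<Rightarrow> 'v::finite set set \<Rightarrow> 'v tensor" where
  "A_alpha \<alpha> k E is =
     of_real \<alpha> * degree_tensor k E is + of_real (1 - \<alpha>) * adjacency_tensor k E is"

definition tensor_apply :: "nat \<Rightarrow> 'v::finite tensor \<Rightarrow> complex ^ 'v \<Rightarrow> complex ^ 'v" where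
  "tensor_apply k T x = (\<chi> i. \<Sum>js\<in>{js. length js = k - 1}. T (i # js) * (\<Prod>j\<leftarrow>js. x $ j))"

definition tensor_eigenvalue :: "nat \<Rightarrow> 'v::finite tensor \<Rightarrow> complex \<Rightarrow> bool" where
  "tensor_eigenvalue k T \<mu> \<longleftrightarrow>
     (\<exists>x. x \<noteq> 0 \<and> (\<forall>i. tensor_apply k T x $ i = \<mu> * (x $ i) ^ (k - 1)))"

text \<open>
  The supremum is a maximum as soon as \<open>T\<close> has an eigenvalue; this is proved below in
  \<open>spectral_radius_attained\<close> and \<open>spectral_radius_upper\<close>.
\<close>

definition spectral_radius :: "nat \<Rightarrow> 'v::finite tensor \<Rightarrow> real" where
  "spectral_radius k T = Sup {cmod \<mu> |\<mu>. tensor_eigenvalue k T \<mu>}"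

definition rho_alpha :: "real \<Rightarrow> nat \<Rightarrow> 'v::finite set set \<Rightarrow> real" where
  "rho_alpha \<alpha> k E = spectral_radius k (A_alpha \<alpha> k E)"

lemma finite_index_lists: "finite {js :: 'v::finite list. length js = l}"
  using finite_lists_length_eq[of "UNIV :: 'v set" l] by simp

lemma tensor_eigenvalue_bound:
  fixes T :: "'v::finite tensor"
  assumes "tensor_eigenvalue k T \<mu>"
  shows "cmod \<mu> \<le> (\<Sum>i\<in>UNIV. \<Sum>js\<in>{js. length js = k - 1}. cmod (T (i # js)))"
proof -
  let ?L = "{js :: 'v list. length js = k - 1}"
  obtain x where x: "x \<noteq> 0" "\<And>i. tensor_apply k T x $ i = \<mu> * (x $ i) ^ (k - 1)"
    using assms unfolding tensor_eigenvalue_def by auto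
  define M where "M = Max (range (\<lambda>i. cmod (x $ i)))"
  have "M \<in> range (\<lambda>i. cmod (x $ i))"
    unfolding M_def by (rule Max_in) auto
  then obtain i where i: "cmod (x $ i) = M" by auto
  have le: "cmod (x $ j) \<le> M" for j
    unfolding M_def by (rule Max_ge) auto
  obtain j where "x $ j \<noteq> 0"
    using x(1) by (auto simp: vec_eq_iff)
  then have M: "M > 0"
    using le[of j] by (smt (verit) zero_less_norm_iff)
  have pr: "cmod (\<Prod>j\<leftarrow>js. x $ j) \<le> M ^ length js" for js
  proof (induction js)
    case (Cons a js)
    then show ?case
      using le[of a] M by (simp add: norm_mult mult_mono)
  qed simp
  have "cmod \<mu> * M ^ (k - 1) = cmod (tensor_apply k T x $ i)"
    by (simp add: x(2) norm_mult norm_power i)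
  also have "\<dots> \<le> (\<Sum>js\<in>?L. cmod (T (i # js)) * M ^ (k - 1))"
    unfolding tensor_apply_def vec_lambda_beta
  proof (rule sum_norm_le)
    fix js assume "js \<in> ?L"
    then show "cmod (T (i # js) * (\<Prod>j\<leftarrow>js. x $ j)) \<le> cmod (T (i # js)) * M ^ (k - 1)"
      using pr[of js] by (simp add: norm_mult mult_left_mono)
  qed
  also have "\<dots> = (\<Sum>js\<in>?L. cmod (T (i # js))) * M ^ (k - 1)"
    by (simp add: sum_distrib_right)
  finally have "cmod \<mu> \<le> (\<Sum>js\<in>?L. cmod (T (i # js)))"
    using M by simp
  also have "\<dots> \<le> (\<Sum>i\<in>UNIV. \<Sum>js\<in>?L. cmod (T (i # js)))"
    by (rule member_le_sum) (auto intro: sum_nonneg)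
  finally show ?thesis .
qed

lemma spectral_radius_upper:
  assumes "tensor_eigenvalue k T \<mu>"
  shows "cmod \<mu> \<le> spectral_radius k T"
  unfolding spectral_radius_def
  by (rule cSup_upper) (use assms tensor_eigenvalue_bound in \<open>auto simp: bdd_above_def\<close>)

lemma tensor_apply_scaleR:
  "tensor_apply k T (c *\<^sub>R x) $ i = of_real c ^ (k - 1) * tensor_apply k T x $ i"
proof -
  have "(\<Prod>j\<leftarrow>js. (c *\<^sub>R x) $ j) = of_real c ^ length js * (\<Prod>j\<leftarrow>js. x $ j)" for js
    by (induction js) (simp_all only: list.map prod_list.Nil prod_list.Cons list.size power_0 power_Suc
      vector_scaleR_component plus_1_eq_Suc, simp_all add: scaleR_conv_of_real[where 'a = complex])
  then show ?thesis
    by (auto simp: tensor_apply_def sum_distrib_left algebra_simps intro!: sum.cong)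
qed

lemma continuous_on_tensor_apply:
  "continuous_on S (\<lambda>p. tensor_apply k T (fst p) $ i)"
proof -
  have "continuous_on S (\<lambda>p. \<Prod>j\<leftarrow>js. fst p $ j)" for js
    by (induction js) (auto intro!: continuous_intros)
  then show ?thesis
    by (auto simp: tensor_apply_def intro!: continuous_intros)
qed

lemma spectral_radius_attained:
  fixes T :: "'v::finite tensor"
  assumes "tensor_eigenvalue k T \<mu>"
  obtains \<nu> where "tensor_eigenvalue k T \<nu>" "cmod \<nu> = spectral_radius k T"
proof -
  define B where "B = (\<Sum>i\<in>UNIV. \<Sum>js\<in>{js. length js = k - 1}. cmod (T (i # js)))"
  define K where "K = {p \<in> sphere 0 1 \<times> cball 0 B.
    \<forall>i. tensor_apply k T (fst p) $ i = snd p * (fst p $ i) ^ (k - 1)}"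
  have "K = (sphere 0 1 \<times> cball 0 B) \<inter>
      (\<Inter>i. {p. tensor_apply k T (fst p) $ i = snd p * (fst p $ i) ^ (k - 1)})"
    unfolding K_def by auto
  moreover have "closed {p. tensor_apply k T (fst p) $ i = snd p * (fst p $ i) ^ (k - 1)}" for i
    by (intro closed_Collect_eq continuous_on_tensor_apply continuous_intros)
  ultimately have K: "compact K"
    by (simp add: compact_Int_closed compact_Times closed_INT)
  have eq: "{cmod \<mu> |\<mu>. tensor_eigenvalue k T \<mu>} = (\<lambda>p. cmod (snd p)) ` K"
  proof (intro equalityI subsetI)
    fix r assume "r \<in> {cmod \<mu> |\<mu>. tensor_eigenvalue k T \<mu>}"
    then obtain l where l: "r = cmod l" "tensor_eigenvalue k T l" by auto
    then obtain x where x: "x \<noteq> 0" "\<And>i. tensor_apply k T x $ i = l * (x $ i) ^ (k - 1)"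
      unfolding tensor_eigenvalue_def by auto
    have "tensor_apply k T ((1 / norm x) *\<^sub>R x) $ i =
        l * (((1 / norm x) *\<^sub>R x) $ i) ^ (k - 1)" for i
      unfolding tensor_apply_scaleR x(2)
      by (simp add: vector_scaleR_component scaleR_conv_of_real[where 'a = complex]
          power_mult_distrib power_divide)
    then have "((1 / norm x) *\<^sub>R x, l) \<in> K"
      using tensor_eigenvalue_bound[OF l(2)] x(1) by (simp add: K_def B_def)
    then show "r \<in> (\<lambda>p. cmod (snd p)) ` K"
      using l(1) by force
  next
    fix r assume "r \<in> (\<lambda>p. cmod (snd p)) ` K"
    then obtain x l where "r = cmod l" "(x, l) \<in> K" by auto
    moreover from this(2) have "x \<noteq> 0" by (auto simp: K_def)
    ultimately show "r \<in> {cmod \<mu> |\<mu>. tensor_eigenvalue k T \<mu>}"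
      unfolding tensor_eigenvalue_def K_def by auto
  qed
  have "compact ((\<lambda>p. cmod (snd p)) ` K)"
    using K by (intro compact_continuous_image continuous_intros)
  then have "closed {cmod \<mu> |\<mu>. tensor_eigenvalue k T \<mu>}"
    unfolding eq by (rule compact_imp_closed)
  then have "spectral_radius k T \<in> {cmod \<mu> |\<mu>. tensor_eigenvalue k T \<mu>}"
    unfolding spectral_radius_def
    by (intro closed_contains_Sup)
      (use assms tensor_eigenvalue_bound in \<open>auto simp: bdd_above_def\<close>)
  then show thesis using that by auto
qed

end

(*
  Connectivity makes the maximiser u of the form of A_alpha on the nonnegative unit sphere of the
  k-norm a positive eigenvector, with an eigenvalue r <= rho_alpha.  Let x >= 0 with sum x_i^k = n.
  Dividing the i-th eigenvector equation by u_i^(k-1), weighting it with (k - 1 + x_i^k)/k, summing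
  over i and using AM-GM in every edge gives
    n r >= alpha sum d_i (k - 1 + x_i^k)/k + (1 - alpha) sum d_i x_i.
  In effect x is put into one slot of the multilinear form and the all-one vector into the others.
  The theorem is the case where x_i is proportional to d_i^(1/(k-1)) on S and equal to 1 off S.
*)

theory Submission
  imports Defs "HOL-Combinatorics.Multiset_Permutations"
begin

section \<open>Adjacency sums and the tensor in coordinates\<close>

text \<open>The \<open>i\<close>-th entry of the adjacency tensor applied to \<open>u\<close>; it is
  also the partial derivative in \<open>u i\<close> of the sum of all edge products.\<close>

definition link_sum :: "'v::finite set set \<Rightarrow> ('v \<Rightarrow> real) \<Rightarrow> 'v \<Rightarrow> real" where
  "link_sum E u i = (\<Sum>e\<in>{e\<in>E. i \<in> e}. \<Prod>j\<in>e - {i}. u j)"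

text \<open>For a \<open>k\<close>-uniform \<open>E\<close> this is the sum over \<open>i\<close> of
  \<open>u i\<close> times the \<open>i\<close>-th entry of the tensor applied to \<open>u\<close>.
  Every edge is met once from each of its \<open>k\<close> vertices, hence the factor
  \<open>k\<close>.\<close>

definition alpha_form :: "real \<Rightarrow> nat \<Rightarrow> 'v::finite set set \<Rightarrow> ('v \<Rightarrow> real) \<Rightarrow> real" where
  "alpha_form \<alpha> k E u =
     \<alpha> * (\<Sum>i\<in>UNIV. real (vertex_degree E i) * u i ^ k) + (1 - \<alpha>) * real k * (\<Sum>e\<in>E. \<Prod>i\<in>e. u i)"

text \<open>Double counting of incidences; \<open>f = 1\<close> later gives the degree sum
  \<open>k * m\<close>.\<close>

lemma sum_degree_weighted:
  fixes E :: "'v::finite set set" and f :: "'v \<Rightarrow> real"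
  shows "(\<Sum>i\<in>UNIV. real (vertex_degree E i) * f i) = (\<Sum>e\<in>E. \<Sum>i\<in>e. f i)"
proof -
  have "(\<Sum>i\<in>UNIV. real (vertex_degree E i) * f i) = (\<Sum>i\<in>UNIV. \<Sum>e\<in>{e\<in>E. i \<in> e}. f i)"
    by (simp add: vertex_degree_def)
  also have "\<dots> = (\<Sum>e\<in>E. \<Sum>i\<in>{i\<in>UNIV. i \<in> e}. f i)"
    by (rule sum.swap_restrict) auto
  finally show ?thesis by simp
qed

text \<open>Every ordering gives the same product. The factorial, with
  \<open>card A = k - 1\<close>, cancels the normalisation of the adjacency tensor.\<close>

lemma sum_permutations_of_set_prod_list:
  fixes f :: "'a \<Rightarrow> 'b::{comm_semiring_1, semiring_char_0}"
  assumes "finite A"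
  shows "(\<Sum>xs\<in>permutations_of_set A. \<Prod>x\<leftarrow>xs. f x) = fact (card A) * prod f A"
proof -
  have "(\<Sum>xs\<in>permutations_of_set A. \<Prod>x\<leftarrow>xs. f x) = (\<Sum>xs\<in>permutations_of_set A. prod f A)"
    by (rule sum.cong) (auto simp: permutations_of_set_def prod.distinct_set_conv_list)
  then show ?thesis using assms by simp
qed

text \<open>In the degree part only the constant list survives. In the adjacency part the lists are
  grouped by the edge that they form with \<open>i\<close>, and each edge arises from the orderings
  of its other vertices.\<close>

lemma tensor_apply_A_alpha:
  fixes E :: "'v::finite set set" and u :: "'v \<Rightarrow> real"
  assumes k: "k \<ge> 1" and E: "uniform_hypergraph k E"
  shows "tensor_apply k (A_alpha \<alpha> k E) (\<chi> i. of_real (u i)) $ i =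
    of_real (\<alpha> * real (vertex_degree E i) * u i ^ (k - 1) + (1 - \<alpha>) * link_sum E u i)"
proof -
  let ?L = "{js :: 'v list. length js = k - 1}"
  let ?x = "\<lambda>j. complex_of_real (u j)"
  let ?p = "\<lambda>js. \<Prod>j\<leftarrow>js. ?x j"
  have fin: "finite ?L" by (rule finite_index_lists)
  have "degree_tensor k E (i # js) = (if js = replicate (k - 1) i then of_nat (vertex_degree E i) else 0)" for js
    using k by (cases k) (auto simp: degree_tensor_def)
  then have "(\<Sum>js\<in>?L. degree_tensor k E (i # js) * ?p js) =
      (\<Sum>js\<in>?L. if js = replicate (k - 1) i then of_nat (vertex_degree E i) * ?p js else 0)"
    by (intro sum.cong) auto
  also have "\<dots> = of_real (real (vertex_degree E i) * u i ^ (k - 1))"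
    using fin by (simp add: prod_list_replicate)
  finally have deg: "(\<Sum>js\<in>?L. degree_tensor k E (i # js) * ?p js) =
    of_real (real (vertex_degree E i) * u i ^ (k - 1))" .
  have perm: "{js\<in>{js\<in>?L. insert i (set js) \<in> E}. insert i (set js) = e} = permutations_of_set (e - {i})"
    if e: "e \<in> E" "i \<in> e" for e
  proof -
    have ce: "card (e - {i}) = k - 1"
      using e E by (auto simp: uniform_hypergraph_def)
    \<comment> \<open>By itself \<open>insert i (set js) = e\<close> allows repetitions and
      \<open>i\<close> in \<open>js\<close>; but the \<open>k - 1\<close> entries have to cover the
      \<open>k - 1\<close> vertices of \<open>e - {i}\<close>, which leaves no room for
      either.\<close>
    have "set js = e - {i} \<and> distinct js" if "length js = k - 1" "insert i (set js) = e" for js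
    proof -
      have sub: "e - {i} \<subseteq> set js" using that by auto
      have "card (set js) \<le> k - 1" using card_length[of js] that by simp
      then have eq: "e - {i} = set js"
        using sub ce by (intro card_seteq) auto
      then show ?thesis using ce that by (metis card_distinct)
    qed
    moreover have "length js = k - 1" "insert i (set js) = e" if "set js = e - {i}" "distinct js" for js
      using that e ce distinct_card[of js] by auto
    ultimately have "length js = k - 1 \<and> insert i (set js) = e \<longleftrightarrow> set js = e - {i} \<and> distinct js" for js
      by blast
    moreover have "{js\<in>{js\<in>?L. insert i (set js) \<in> E}. insert i (set js) = e} =
        {js. length js = k - 1 \<and> insert i (set js) = e}"
      using e by auto
    ultimately show ?thesis
      by (simp only: permutations_of_set_def)
  qed
  have "(\<Sum>js\<in>?L. adjacency_tensor k E (i # js) * ?p js) =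
      (\<Sum>js\<in>?L. if insert i (set js) \<in> E then ?p js / fact (k - 1) else 0)"
    by (intro sum.cong) (auto simp: adjacency_tensor_def)
  also have "\<dots> = (\<Sum>js\<in>{js\<in>?L. insert i (set js) \<in> E}. ?p js / fact (k - 1))"
    using fin by (rule sum.inter_filter[symmetric])
  also have "\<dots> = (\<Sum>e\<in>{e\<in>E. i \<in> e}.
      \<Sum>js\<in>{js\<in>{js\<in>?L. insert i (set js) \<in> E}. insert i (set js) = e}. ?p js / fact (k - 1))"
    using fin by (intro sum.group[symmetric]) auto
  also have "\<dots> = (\<Sum>e\<in>{e\<in>E. i \<in> e}. \<Prod>j\<in>e - {i}. ?x j)"
  proof (rule sum.cong)
    fix e assume "e \<in> {e\<in>E. i \<in> e}"
    then have e: "e \<in> E" "i \<in> e" by auto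
    have "card (e - {i}) = k - 1"
      using e E by (auto simp: uniform_hypergraph_def)
    then have "(\<Sum>js\<in>permutations_of_set (e - {i}). ?p js / fact (k - 1)) = (\<Prod>j\<in>e - {i}. ?x j)"
      using sum_permutations_of_set_prod_list[of "e - {i}" ?x]
      by (simp add: sum_divide_distrib[symmetric])
    then show "(\<Sum>js\<in>{js\<in>{js\<in>?L. insert i (set js) \<in> E}. insert i (set js) = e}. ?p js / fact (k - 1)) =
        (\<Prod>j\<in>e - {i}. ?x j)"
      unfolding perm[OF e] .
  qed simp
  also have "\<dots> = of_real (link_sum E u i)"
    by (simp add: link_sum_def)
  finally have adj: "(\<Sum>js\<in>?L. adjacency_tensor k E (i # js) * ?p js) = of_real (link_sum E u i)" .
  have "tensor_apply k (A_alpha \<alpha> k E) (\<chi> i. of_real (u i)) $ i =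
      (\<Sum>js\<in>?L. A_alpha \<alpha> k E (i # js) * ?p js)"
    by (simp add: tensor_apply_def)
  also have "\<dots> = of_real \<alpha> * (\<Sum>js\<in>?L. degree_tensor k E (i # js) * ?p js) +
      of_real (1 - \<alpha>) * (\<Sum>js\<in>?L. adjacency_tensor k E (i # js) * ?p js)"
    by (simp only: A_alpha_def sum_distrib_left sum.distrib[symmetric] distrib_right mult.assoc)
  finally show ?thesis
    unfolding deg adj by simp
qed

section \<open>Maximisers of the form on the nonnegative sphere\<close>

text \<open>Homogeneity, since every edge has exactly \<open>k\<close> vertices. It carries
  maximality from the unit sphere to all nonnegative vectors.\<close>

lemma alpha_form_scale:
  assumes "uniform_hypergraph k E"
  shows "alpha_form \<alpha> k E (\<lambda>i. c * u i) = c ^ k * alpha_form \<alpha> k E u"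
proof -
  have "(\<Prod>i\<in>e. c * u i) = c ^ k * (\<Prod>i\<in>e. u i)" if "e \<in> E" for e
    using that assms by (simp add: uniform_hypergraph_def prod.distrib)
  then have "(\<Sum>e\<in>E. \<Prod>i\<in>e. c * u i) = c ^ k * (\<Sum>e\<in>E. \<Prod>i\<in>e. u i)"
    by (simp add: sum_distrib_left)
  moreover have "(\<Sum>i\<in>UNIV. real (vertex_degree E i) * (c * u i) ^ k) =
      c ^ k * (\<Sum>i\<in>UNIV. real (vertex_degree E i) * u i ^ k)"
    by (simp add: sum_distrib_left power_mult_distrib algebra_simps)
  ultimately show ?thesis
    by (simp add: alpha_form_def algebra_simps)
qed

text \<open>The nonnegative part of the unit sphere of the \<open>k\<close>-norm is compact. The
  third property is maximality in homogeneous form, so that perturbed vectors need no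
  normalisation.\<close>

lemma alpha_form_maximizer:
  fixes E :: "'v::finite set set"
  assumes k: "k \<ge> 1" and E: "uniform_hypergraph k E"
  obtains u :: "'v \<Rightarrow> real" where "\<And>i. u i \<ge> 0" "(\<Sum>i\<in>UNIV. u i ^ k) = 1"
    "\<And>y :: 'v \<Rightarrow> real. (\<And>i. y i \<ge> 0) \<Longrightarrow>
       alpha_form \<alpha> k E y \<le> alpha_form \<alpha> k E u * (\<Sum>i\<in>UNIV. y i ^ k)"
proof -
  define K where "K = {x :: real ^ 'v. (\<forall>i. 0 \<le> x $ i) \<and> (\<Sum>i\<in>UNIV. (x $ i) ^ k) = 1}"
  have "x $ i \<le> 1" if "x \<in> K" for x i
  proof -
    have "(x $ i) ^ k \<le> (\<Sum>i\<in>UNIV. (x $ i) ^ k)"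
      using that by (intro member_le_sum) (auto simp: K_def)
    then have "(x $ i) ^ k \<le> 1 ^ k" using that by (simp add: K_def)
    then show ?thesis using that k by (subst (asm) power_mono_iff) (auto simp: K_def)
  qed
  then have "K \<subseteq> cbox 0 1"
    by (auto simp: mem_box_cart K_def)
  then have "bounded K" using bounded_cbox bounded_subset by blast
  moreover have "closed K"
    unfolding K_def Collect_conj_eq
    by (intro closed_Int closed_Collect_all closed_Collect_le closed_Collect_eq continuous_intros)
  ultimately have "compact K" by (simp add: compact_eq_bounded_closed)
  \<comment> \<open>A unit vector shows that \<open>K\<close> is nonempty; \<open>undefined\<close>
    merely names some vertex.\<close>
  moreover have "axis (undefined :: 'v) 1 \<in> K"
  proof -
    have "(\<Sum>i\<in>UNIV. (axis (undefined :: 'v) (1::real) $ i) ^ k) = (\<Sum>i\<in>UNIV. if i = (undefined :: 'v) then 1 else 0)"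
      using k by (intro sum.cong) (auto simp: axis_def)
    then show ?thesis by (auto simp: K_def axis_def)
  qed
  moreover have "continuous_on K (\<lambda>x. alpha_form \<alpha> k E (\<lambda>i. x $ i))"
    unfolding alpha_form_def by (intro continuous_intros)
  ultimately obtain x where x: "x \<in> K"
    "\<And>y. y \<in> K \<Longrightarrow> alpha_form \<alpha> k E (\<lambda>i. y $ i) \<le> alpha_form \<alpha> k E (\<lambda>i. x $ i)"
    using continuous_attains_sup[of K "\<lambda>x. alpha_form \<alpha> k E (\<lambda>i. x $ i)"] by blast
  show thesis
  proof (rule that)
    show "x $ i \<ge> 0" for i using x(1) by (simp add: K_def)
    show "(\<Sum>i\<in>UNIV. (x $ i) ^ k) = 1" using x(1) by (simp add: K_def)
    fix y :: "'v \<Rightarrow> real" assume y: "\<And>i. y i \<ge> 0"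
    define N where "N = (\<Sum>i\<in>UNIV. y i ^ k)"
    have N0: "N \<ge> 0" unfolding N_def by (intro sum_nonneg) (simp add: y)
    show "alpha_form \<alpha> k E y \<le> alpha_form \<alpha> k E (\<lambda>i. x $ i) * (\<Sum>i\<in>UNIV. y i ^ k)"
    proof (cases "N = 0")
      case True
      then have "y i = 0" for i
        unfolding N_def using y k by (subst (asm) sum_nonneg_eq_0_iff) auto
      \<comment> \<open>The zero vector cannot be normalised; homogeneity with factor 0 gives its
        value.\<close>
      then have "alpha_form \<alpha> k E y = alpha_form \<alpha> k E (\<lambda>i. 0 * y i)" by (intro arg_cong[where f = "alpha_form \<alpha> k E"] ext) simp
      also have "\<dots> = 0" using k by (subst alpha_form_scale[OF E]) simp
      finally show ?thesis using True by (simp add: N_def)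
    next
      case False
      define c where "c = 1 / root k N"
      have c: "c \<ge> 0" "c ^ k = 1 / N"
        using N0 k by (simp_all add: c_def power_divide)
      have "(\<Sum>i\<in>UNIV. (c * y i) ^ k) = c ^ k * N"
        by (simp add: N_def power_mult_distrib sum_distrib_left)
      then have "(\<chi> i. c * y i) \<in> K"
        using c y False by (simp add: K_def)
      from x(2)[OF this] have "c ^ k * alpha_form \<alpha> k E y \<le> alpha_form \<alpha> k E (\<lambda>i. x $ i)"
        by (simp add: alpha_form_scale[OF E])
      then show ?thesis
        using False N0 by (simp add: c N_def[symmetric] field_simps)
    qed
  qed
qed

section \<open>Connectivity and positivity of the maximiser\<close>

text \<open>A walk from a vertex of \<open>Z\<close> to one outside has to leave \<open>Z\<close>
  within some edge.\<close>

lemma connected_hypergraph_crossing_edge: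
  assumes "connected_hypergraph E" "Z \<noteq> {}" "Z \<noteq> UNIV"
  obtains e where "e \<in> E" "e \<inter> Z \<noteq> {}" "e - Z \<noteq> {}"
proof -
  obtain a b where ab: "a \<in> Z" "b \<notin> Z" using assms by auto
  have "(a, b) \<in> {(a, b). \<exists>e\<in>E. {a, b} \<subseteq> e}\<^sup>*"
    using assms unfolding connected_hypergraph_def by blast
  then have "b \<notin> Z \<longrightarrow> (\<exists>e\<in>E. e \<inter> Z \<noteq> {} \<and> e - Z \<noteq> {})"
    by (induction rule: rtrancl_induct) (use ab in auto)
  then show thesis using ab that by blast
qed

text \<open>An edge crosses the proper subset \<open>{i}\<close>. A single vertex would be connected
  by the empty walk without any edge, hence the bound on \<open>CARD('v)\<close>.\<close>

lemma connected_hypergraph_degree_pos: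
  fixes E :: "'v::finite set set"
  assumes "connected_hypergraph E" "CARD('v) \<ge> 2"
  shows "vertex_degree E i > 0"
proof -
  have "{i} \<noteq> (UNIV :: 'v set)"
  proof
    assume "{i} = (UNIV :: 'v set)"
    then have "CARD('v) = card {i}" by simp
    then show False using assms(2) by simp
  qed
  then obtain e where "e \<in> E" "e \<inter> {i} \<noteq> {}"
    using connected_hypergraph_crossing_edge[OF assms(1), of "{i}"] by blast
  then show ?thesis by (auto simp: vertex_degree_def card_gt_0_iff)
qed

text \<open>
  Raising the vanishing entries of a maximiser to \<open>t\<close> would increase the form by an order of
  at most \<open>t ^ (k - 1)\<close> through an edge that crosses the zero set, but the norm only by order \<open>t ^ k\<close>.
\<close>

lemma alpha_form_maximizer_pos:
  fixes E :: "'v::finite set set" and u :: "'v \<Rightarrow> real"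
  assumes k: "k \<ge> 1" and \<alpha>: "0 \<le> \<alpha>" "\<alpha> < 1"
    and E: "uniform_hypergraph k E" "connected_hypergraph E"
    and u: "\<And>i. u i \<ge> 0" "(\<Sum>i\<in>UNIV. u i ^ k) = 1"
    and max: "\<And>y :: 'v \<Rightarrow> real. (\<And>i. y i \<ge> 0) \<Longrightarrow>
       alpha_form \<alpha> k E y \<le> alpha_form \<alpha> k E u * (\<Sum>i\<in>UNIV. y i ^ k)"
  shows "u i > 0"
proof (rule ccontr)
  assume "\<not> u i > 0"
  define Z where "Z = {i. u i = 0}"
  have "i \<in> Z" using \<open>\<not> u i > 0\<close> u(1)[of i] by (simp add: Z_def)
  moreover have "Z \<noteq> UNIV"
  proof
    assume "Z = UNIV"
    then have "u j = 0" for j by (auto simp: Z_def)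
    then show False using u(2) k by (simp add: power_0_left)
  qed
  ultimately obtain f where f: "f \<in> E" "f \<inter> Z \<noteq> {}" "f - Z \<noteq> {}"
    using connected_hypergraph_crossing_edge[OF E(2), of Z] by auto
  define r where "r = alpha_form \<alpha> k E u"
  \<comment> \<open>The coefficient of the gain through \<open>f\<close>: its vertices outside
    \<open>Z\<close> keep their positive values.\<close>
  define c where "c = (1 - \<alpha>) * real k * (\<Prod>j\<in>f - Z. u j)"
  have "(\<Prod>j\<in>f - Z. u j) > 0"
    using u(1) by (intro prod_pos) (auto simp: Z_def intro: le_neq_trans)
  then have c: "c > 0" using \<alpha> k by (simp add: c_def)
  have key: "c \<le> r * real (card Z) * t" if t: "0 < t" "t \<le> 1" for t
  proof -
    define y where "y = (\<lambda>j. if j \<in> Z then t else u j)"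
    have y0: "y j \<ge> 0" for j using u(1) t by (simp add: y_def)
    have uy: "u j \<le> y j" for j using t by (simp add: y_def Z_def)
    have cf: "card f = k" using f E by (simp add: uniform_hypergraph_def)
    \<comment> \<open>Since \<open>f\<close> has a vertex outside \<open>Z\<close>, at most
      \<open>k - 1\<close> of its entries are raised to \<open>t\<close>.\<close>
    have "card (f \<inter> Z) < card f" using f by (intro psubset_card_mono) auto
    then have "t ^ (k - 1) \<le> t ^ card (f \<inter> Z)"
      using t cf by (intro power_decreasing) auto
    have py: "(\<Prod>j\<in>f. y j) = (\<Prod>j\<in>f - Z. u j) * t ^ card (f \<inter> Z)"
    proof -
      have "(\<Prod>j\<in>f. y j) = (\<Prod>j\<in>f - Z. y j) * (\<Prod>j\<in>f \<inter> Z. y j)"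
        by (subst prod.union_disjoint[symmetric]) (auto intro!: prod.cong)
      then show ?thesis by (simp add: y_def)
    qed
    have pu: "(\<Prod>j\<in>f. u j) = 0" using f by (auto simp: Z_def)
    \<comment> \<open>No entry decreases, so the other edges lose nothing; \<open>f\<close> itself
      contributed 0 before.\<close>
    have "(\<Sum>e\<in>E. \<Prod>j\<in>e. u j) + (\<Prod>j\<in>f. y j) \<le> (\<Sum>e\<in>E. \<Prod>j\<in>e. y j)"
    proof -
      have "(\<Sum>e\<in>E - {f}. \<Prod>j\<in>e. u j) \<le> (\<Sum>e\<in>E - {f}. \<Prod>j\<in>e. y j)"
        by (intro sum_mono prod_mono) (simp add: u uy)
      then show ?thesis unfolding sum.remove[OF finite f(1)] pu by simp
    qed
    then have "(1 - \<alpha>) * real k * ((\<Sum>e\<in>E. \<Prod>j\<in>e. u j) + (\<Prod>j\<in>f. y j)) \<le>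
        (1 - \<alpha>) * real k * (\<Sum>e\<in>E. \<Prod>j\<in>e. y j)"
      using \<alpha> by (intro mult_left_mono) auto
    moreover have "\<alpha> * (\<Sum>i\<in>UNIV. real (vertex_degree E i) * u i ^ k) \<le>
        \<alpha> * (\<Sum>i\<in>UNIV. real (vertex_degree E i) * y i ^ k)"
      using \<alpha> by (intro mult_left_mono sum_mono power_mono) (auto simp: u uy)
    ultimately have "r + (1 - \<alpha>) * real k * (\<Prod>j\<in>f. y j) \<le> alpha_form \<alpha> k E y"
      by (simp add: r_def alpha_form_def algebra_simps)
    also have "\<dots> \<le> r * (\<Sum>i\<in>UNIV. y i ^ k)"
      unfolding r_def by (rule max) (rule y0)
    also have "(\<Sum>i\<in>UNIV. y i ^ k) = (\<Sum>i\<in>UNIV. u i ^ k + (if i \<in> Z then t ^ k else 0))"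
      using k by (intro sum.cong) (auto simp: y_def Z_def)
    also have "\<dots> = 1 + real (card Z) * t ^ k"
      by (simp add: sum.distrib u(2) sum.If_cases)
    finally have "c * t ^ card (f \<inter> Z) \<le> r * real (card Z) * t ^ k"
      by (simp add: py c_def algebra_simps)
    then have "c * t ^ (k - 1) \<le> r * real (card Z) * t ^ k"
      using mult_left_mono[OF \<open>t ^ (k - 1) \<le> _\<close>, of c] c by linarith
    also have "t ^ k = t * t ^ (k - 1)" using k by (cases k) auto
    finally show ?thesis using t by (simp add: mult.assoc[symmetric])
  qed
  define M where "M = r * real (card Z)"
  have M: "M > 0" using key[of 1] c by (simp add: M_def)
  \<comment> \<open>With this \<open>t\<close>, the bound \<open>key\<close> yields
    \<open>c \<le> c / 2\<close>.\<close>
  define t where "t = min 1 (c / (2 * M))"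
  have "c \<le> M * t" using key[of t] M c by (simp add: M_def t_def)
  also have "\<dots> \<le> M * (c / (2 * M))"
    using M by (intro mult_left_mono) (auto simp: t_def)
  finally show False using M c by simp
qed

section \<open>The eigenvector equation\<close>

text \<open>Edges are sets, so one entry enters each edge product at most linearly; the power
  \<open>t ^ k\<close> comes from the degree term alone. The last bracket is constant in
  \<open>t\<close>.\<close>

lemma alpha_form_fun_upd:
  fixes E :: "'v::finite set set"
  shows "alpha_form \<alpha> k E (u(i := t)) =
    \<alpha> * real (vertex_degree E i) * t ^ k + (1 - \<alpha>) * real k * link_sum E u i * t
    + (\<alpha> * (\<Sum>j\<in>UNIV - {i}. real (vertex_degree E j) * u j ^ k)
       + (1 - \<alpha>) * real k * (\<Sum>e\<in>{e\<in>E. i \<notin> e}. \<Prod>j\<in>e. u j))"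
proof -
  have "(\<Sum>j\<in>UNIV. real (vertex_degree E j) * (u(i := t)) j ^ k) =
      real (vertex_degree E i) * t ^ k + (\<Sum>j\<in>UNIV - {i}. real (vertex_degree E j) * u j ^ k)"
    by (subst sum.remove[of _ i]) auto
  moreover have "(\<Sum>e\<in>E. \<Prod>j\<in>e. (u(i := t)) j) =
      t * link_sum E u i + (\<Sum>e\<in>{e\<in>E. i \<notin> e}. \<Prod>j\<in>e. u j)"
  proof -
    have "(\<Sum>e\<in>E. \<Prod>j\<in>e. (u(i := t)) j) =
        (\<Sum>e\<in>{e\<in>E. i \<in> e}. \<Prod>j\<in>e. (u(i := t)) j) + (\<Sum>e\<in>{e\<in>E. i \<notin> e}. \<Prod>j\<in>e. (u(i := t)) j)"
      by (subst sum.union_disjoint[symmetric]) (auto intro!: sum.cong)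
    also have "(\<Sum>e\<in>{e\<in>E. i \<in> e}. \<Prod>j\<in>e. (u(i := t)) j) = t * link_sum E u i"
      unfolding link_sum_def sum_distrib_left
    proof (rule sum.cong)
      fix e assume "e \<in> {e\<in>E. i \<in> e}"
      then have "(\<Prod>j\<in>e. (u(i := t)) j) = t * (\<Prod>j\<in>e - {i}. (u(i := t)) j)"
        by (subst prod.remove[of _ i]) auto
      also have "(\<Prod>j\<in>e - {i}. (u(i := t)) j) = (\<Prod>j\<in>e - {i}. u j)"
        by (intro prod.cong) auto
      finally show "(\<Prod>j\<in>e. (u(i := t)) j) = t * (\<Prod>j\<in>e - {i}. u j)" .
    qed simp
    also have "(\<Sum>e\<in>{e\<in>E. i \<notin> e}. \<Prod>j\<in>e. (u(i := t)) j) = (\<Sum>e\<in>{e\<in>E. i \<notin> e}. \<Prod>j\<in>e. u j)"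
      by (intro sum.cong prod.cong) auto
    finally show ?thesis .
  qed
  ultimately show ?thesis
    by (simp add: alpha_form_def algebra_simps)
qed

text \<open>With \<open>r\<close> the value at \<open>u\<close>, the form minus \<open>r\<close>
  times the sum of \<open>k\<close>-th powers is at most 0 on nonnegative vectors and 0 at
  \<open>u\<close>. Since \<open>u\<close> is positive, each entry can vary in both directions, so
  the partial derivatives vanish; \<open>r\<close> acts as a Lagrange multiplier.\<close>

lemma alpha_form_maximizer_eigen:
  fixes E :: "'v::finite set set" and u :: "'v \<Rightarrow> real"
  assumes k: "k \<ge> 1"
    and u: "\<And>i. u i > 0" "(\<Sum>i\<in>UNIV. u i ^ k) = 1"
    and max: "\<And>y :: 'v \<Rightarrow> real. (\<And>i. y i \<ge> 0) \<Longrightarrow>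
       alpha_form \<alpha> k E y \<le> alpha_form \<alpha> k E u * (\<Sum>i\<in>UNIV. y i ^ k)"
  shows "\<alpha> * real (vertex_degree E i) * u i ^ (k - 1) + (1 - \<alpha>) * link_sum E u i =
    alpha_form \<alpha> k E u * u i ^ (k - 1)"
proof -
  define r where "r = alpha_form \<alpha> k E u"
  define F where "F = (\<lambda>t. alpha_form \<alpha> k E (u(i := t)) - r * (\<Sum>j\<in>UNIV. (u(i := t)) j ^ k))"
  define C where "C = \<alpha> * (\<Sum>j\<in>UNIV - {i}. real (vertex_degree E j) * u j ^ k)
       + (1 - \<alpha>) * real k * (\<Sum>e\<in>{e\<in>E. i \<notin> e}. \<Prod>j\<in>e. u j) - r * (\<Sum>j\<in>UNIV - {i}. u j ^ k)"
  have F: "F t = (\<alpha> * real (vertex_degree E i) - r) * t ^ k + (1 - \<alpha>) * real k * link_sum E u i * t + C" for t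
  proof -
    have "(\<Sum>j\<in>UNIV. (u(i := t)) j ^ k) = t ^ k + (\<Sum>j\<in>UNIV - {i}. u j ^ k)"
      by (subst sum.remove[of _ i]) auto
    then show ?thesis
      by (simp add: F_def C_def alpha_form_fun_upd algebra_simps)
  qed
  have "DERIV F (u i) :> (\<alpha> * real (vertex_degree E i) - r) * (real k * u i ^ (k - 1))
      + (1 - \<alpha>) * real k * link_sum E u i"
    unfolding F[abs_def] by (auto intro!: derivative_eq_intros)
  \<comment> \<open>The radius \<open>u i\<close> keeps \<open>t\<close> positive, so that
    \<open>max\<close> applies to \<open>u(i := t)\<close>.\<close>
  moreover have "F t \<le> F (u i)" if "\<bar>u i - t\<bar> < u i" for t
  proof -
    have "F t \<le> 0"
      unfolding F_def r_def using that u(1) max[of "u(i := t)"] by (force simp: less_imp_le)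
    also have "0 = F (u i)" using u(2) by (simp only: F_def r_def fun_upd_triv)
    finally show ?thesis .
  qed
  ultimately have "(\<alpha> * real (vertex_degree E i) - r) * (real k * u i ^ (k - 1))
      + (1 - \<alpha>) * real k * link_sum E u i = 0"
    using DERIV_local_max[OF _ u(1)] by blast
  then have "real k * ((\<alpha> * real (vertex_degree E i) - r) * u i ^ (k - 1) + (1 - \<alpha>) * link_sum E u i) = 0"
    by (simp add: algebra_simps)
  then have "(\<alpha> * real (vertex_degree E i) - r) * u i ^ (k - 1) + (1 - \<alpha>) * link_sum E u i = 0"
    using k by (subst (asm) mult_eq_0_iff) auto
  then show ?thesis
    by (simp add: r_def algebra_simps)
qed

section \<open>AM-GM in an edge\<close>

text \<open>The geometric mean of the numbers \<open>z i ^ k\<close> is the product of the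
  \<open>z i\<close> because there are exactly \<open>k\<close> of them.\<close>

lemma am_gm_power:
  fixes z :: "'a \<Rightarrow> real"
  assumes "finite A" "card A = k" "k > 0" "\<And>i. i \<in> A \<Longrightarrow> z i \<ge> 0"
  shows "real k * (\<Prod>i\<in>A. z i) \<le> (\<Sum>i\<in>A. z i ^ k)"
proof -
  have "A \<noteq> {}" using assms by auto
  have "(\<Prod>i\<in>A. z i ^ k) powr (1 / card A) \<le> (\<Sum>i\<in>A. z i ^ k / card A)"
    using assms \<open>A \<noteq> {}\<close> by (intro arith_geom_mean) auto
  moreover have "(\<Prod>i\<in>A. z i ^ k) powr (1 / card A) = (\<Prod>i\<in>A. z i)"
    using assms by (simp add: prod_power_distrib[symmetric] prod_nonneg real_root_power_cancel
      flip: root_powr_inverse)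
  ultimately show ?thesis
    using assms by (simp add: sum_divide_distrib[symmetric] field_simps)
qed

text \<open>
  AM-GM is applied once for every \<open>j\<close> in the edge, to the vector that equals \<open>x j / u j\<close> at \<open>j\<close>
  and \<open>1 / u i\<close> elsewhere.
\<close>

lemma edge_sum_le:
  fixes u x :: "'a \<Rightarrow> real"
  assumes e: "finite e" "card e = k" "k > 0"
    and u: "\<And>i. u i > 0" and x: "\<And>i. x i \<ge> 0"
  shows "(\<Sum>i\<in>e. x i) \<le> (\<Sum>i\<in>e. (real k - 1 + x i ^ k) / real k * (\<Prod>j\<in>e. u j) / u i ^ k)"
proof -
  define U where "U = (\<Prod>j\<in>e. u j)"
  have U: "U > 0" unfolding U_def by (intro prod_pos) (simp add: u)
  have "real k * (\<Sum>j\<in>e. x j / U) \<le> (\<Sum>j\<in>e. \<Sum>i\<in>e. (if i = j then x j ^ k else 1) / u i ^ k)"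
    unfolding sum_distrib_left
  proof (rule sum_mono)
    fix j assume j: "j \<in> e"
    have "(\<Prod>i\<in>e. (if i = j then x j else 1) / u i) = x j / U"
      using j e by (simp add: prod_dividef U_def)
    moreover have "real k * (\<Prod>i\<in>e. (if i = j then x j else 1) / u i) \<le>
        (\<Sum>i\<in>e. ((if i = j then x j else 1) / u i) ^ k)"
      using e x u by (intro am_gm_power) (auto simp: less_imp_le)
    moreover have "((if i = j then x j else 1) / u i) ^ k = (if i = j then x j ^ k else 1) / u i ^ k" for i
      by (simp add: power_divide)
    ultimately show "real k * (x j / U) \<le> (\<Sum>i\<in>e. (if i = j then x j ^ k else 1) / u i ^ k)"
      by simp
  qed
  also have "\<dots> = (\<Sum>i\<in>e. \<Sum>j\<in>e. (if i = j then x j ^ k else 1) / u i ^ k)"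
    by (rule sum.swap)
  also have "\<dots> = (\<Sum>i\<in>e. (real k - 1 + x i ^ k) / u i ^ k)"
  proof (rule sum.cong)
    fix i assume i: "i \<in> e"
    \<comment> \<open>In the coefficient of \<open>1 / u i ^ k\<close> the choice
      \<open>j = i\<close> gives \<open>x i ^ k\<close> and each of the other \<open>k - 1\<close>
      choices gives 1. This is the origin of the weight
      \<open>(k - 1 + x i ^ k) / k\<close>.\<close>
    have "(\<Sum>j\<in>e. if i = j then x j ^ k else 1) = x i ^ k + (\<Sum>j\<in>e - {i}. if i = j then x j ^ k else 1)"
      using i e by (subst sum.remove[of _ i]) auto
    also have "(\<Sum>j\<in>e - {i}. if i = j then x j ^ k else 1) = (\<Sum>j\<in>e - {i}. 1)"
      by (intro sum.cong) auto
    finally show "(\<Sum>j\<in>e. (if i = j then x j ^ k else 1) / u i ^ k) = (real k - 1 + x i ^ k) / u i ^ k"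
      using i e by (simp add: sum_divide_distrib[symmetric] of_nat_diff)
  qed simp
  finally have "real k * (\<Sum>j\<in>e. x j / U) * (U / k) \<le> (\<Sum>i\<in>e. (real k - 1 + x i ^ k) / u i ^ k) * (U / k)"
    using U by (intro mult_right_mono) auto
  moreover have "real k * (\<Sum>j\<in>e. x j / U) * (U / k) = (\<Sum>j\<in>e. x j)"
    using U e by (simp add: sum_divide_distrib[symmetric])
  moreover have "(\<Sum>i\<in>e. (real k - 1 + x i ^ k) / u i ^ k) * (U / k) =
      (\<Sum>i\<in>e. (real k - 1 + x i ^ k) / real k * U / u i ^ k)"
    unfolding sum_distrib_right by (intro sum.cong) (simp_all add: field_simps)
  ultimately show ?thesis unfolding U_def by simp
qed

section \<open>The lower bound for a general test vector\<close>

text \<open>The normalisation of \<open>x\<close> makes the weights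
  \<open>(k - 1 + x i ^ k) / k\<close> sum to \<open>CARD('v)\<close>, so the weighted eigenvector
  equations add up to that multiple of the eigenvalue. For \<open>x = 1\<close> the bound says that
  \<open>rho_alpha\<close> is at least the average degree.\<close>

lemma rho_alpha_lower_bound:
  fixes E :: "'v::finite set set" and x :: "'v \<Rightarrow> real"
  assumes k: "k \<ge> 1" and \<alpha>: "0 \<le> \<alpha>" "\<alpha> < 1"
    and E: "uniform_hypergraph k E" "connected_hypergraph E"
    and x: "\<And>i. x i \<ge> 0" "(\<Sum>i\<in>UNIV. x i ^ k) = real CARD('v)"
  shows "\<alpha> * (\<Sum>i\<in>UNIV. real (vertex_degree E i) * ((real k - 1 + x i ^ k) / real k))
    + (1 - \<alpha>) * (\<Sum>i\<in>UNIV. real (vertex_degree E i) * x i) \<le> real CARD('v) * rho_alpha \<alpha> k E"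
proof -
  obtain u :: "'v \<Rightarrow> real" where u: "\<And>i. u i \<ge> 0" "(\<Sum>i\<in>UNIV. u i ^ k) = 1"
    "\<And>y :: 'v \<Rightarrow> real. (\<And>i. y i \<ge> 0) \<Longrightarrow>
       alpha_form \<alpha> k E y \<le> alpha_form \<alpha> k E u * (\<Sum>i\<in>UNIV. y i ^ k)"
    using alpha_form_maximizer[OF k E(1), of \<alpha>] by blast
  have upos: "u i > 0" for i
    using k \<alpha> E u by (rule alpha_form_maximizer_pos)
  define r where "r = alpha_form \<alpha> k E u"
  have eig: "\<alpha> * real (vertex_degree E i) * u i ^ (k - 1) + (1 - \<alpha>) * link_sum E u i = r * u i ^ (k - 1)" for i
    unfolding r_def using k upos u(2,3) by (rule alpha_form_maximizer_eigen)
  have "tensor_eigenvalue k (A_alpha \<alpha> k E) (of_real r)"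
    unfolding tensor_eigenvalue_def
  proof (intro exI conjI allI)
    show "(\<chi> i. complex_of_real (u i)) \<noteq> 0"
      using upos[THEN less_imp_neq] by (auto simp: vec_eq_iff)
    show "tensor_apply k (A_alpha \<alpha> k E) (\<chi> i. of_real (u i)) $ i =
        of_real r * ((\<chi> i. of_real (u i)) $ i) ^ (k - 1)" for i
      unfolding tensor_apply_A_alpha[OF k E(1)] eig by simp
  qed
  from spectral_radius_upper[OF this] have rho: "r \<le> rho_alpha \<alpha> k E"
    by (simp add: rho_alpha_def)
  define w where "w = (\<lambda>i. (real k - 1 + x i ^ k) / real k)"
  have sw: "(\<Sum>i\<in>UNIV. w i) = real CARD('v)"
    using k by (simp add: w_def sum_divide_distrib[symmetric] sum.distrib x(2) sum_subtractf field_simps)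
  have "(\<Sum>i\<in>UNIV. real (vertex_degree E i) * x i) = (\<Sum>e\<in>E. \<Sum>i\<in>e. x i)"
    by (rule sum_degree_weighted)
  also have "\<dots> \<le> (\<Sum>e\<in>E. \<Sum>i\<in>e. w i * (\<Prod>j\<in>e. u j) / u i ^ k)"
    unfolding w_def using E(1) k
    by (intro sum_mono edge_sum_le) (auto simp: upos x uniform_hypergraph_def)
  \<comment> \<open>Exchanging the sums collects at each vertex the edges through it, that is, its
    link sum.\<close>
  also have "\<dots> = (\<Sum>e\<in>E. \<Sum>i\<in>{i\<in>UNIV. i \<in> e}. w i * (\<Prod>j\<in>e. u j) / u i ^ k)"
    by simp
  also have "\<dots> = (\<Sum>i\<in>UNIV. \<Sum>e\<in>{e\<in>E. i \<in> e}. w i * (\<Prod>j\<in>e. u j) / u i ^ k)"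
    by (rule sum.swap_restrict) auto
  also have "\<dots> = (\<Sum>i\<in>UNIV. w i * (link_sum E u i / u i ^ (k - 1)))"
  proof (rule sum.cong)
    fix i
    have "(\<Prod>j\<in>e. u j) / u i ^ k = (\<Prod>j\<in>e - {i}. u j) / u i ^ (k - 1)" if "i \<in> e" for e
      using that k upos[of i] by (cases k) (auto simp: prod.remove[of e i])
    then have "(\<Sum>e\<in>{e\<in>E. i \<in> e}. w i * ((\<Prod>j\<in>e. u j) / u i ^ k)) =
        (\<Sum>e\<in>{e\<in>E. i \<in> e}. w i * ((\<Prod>j\<in>e - {i}. u j) / u i ^ (k - 1)))"
      by (intro sum.cong) auto
    then show "(\<Sum>e\<in>{e\<in>E. i \<in> e}. w i * (\<Prod>j\<in>e. u j) / u i ^ k) = w i * (link_sum E u i / u i ^ (k - 1))"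
      by (simp add: link_sum_def sum_distrib_left sum_divide_distrib)
  qed simp
  finally have "(1 - \<alpha>) * (\<Sum>i\<in>UNIV. real (vertex_degree E i) * x i) \<le>
      (1 - \<alpha>) * (\<Sum>i\<in>UNIV. w i * (link_sum E u i / u i ^ (k - 1)))"
    using \<alpha> by (intro mult_left_mono) auto
  also have "\<dots> = (\<Sum>i\<in>UNIV. w i * (r - \<alpha> * real (vertex_degree E i)))"
    unfolding sum_distrib_left
  proof (rule sum.cong)
    fix i
    \<comment> \<open>The eigenvector equation at \<open>i\<close>, divided by
      \<open>u i ^ (k - 1)\<close>.\<close>
    have "(1 - \<alpha>) * (link_sum E u i / u i ^ (k - 1)) = r - \<alpha> * real (vertex_degree E i)"
      using eig[of i] upos[of i] by (simp add: field_simps)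
    then show "(1 - \<alpha>) * (w i * (link_sum E u i / u i ^ (k - 1))) = w i * (r - \<alpha> * real (vertex_degree E i))"
      by (metis mult.left_commute)
  qed simp
  also have "\<dots> = real CARD('v) * r - \<alpha> * (\<Sum>i\<in>UNIV. real (vertex_degree E i) * w i)"
    unfolding sw[symmetric] by (simp add: sum_distrib_left sum_distrib_right sum_subtractf algebra_simps)
  also have "\<dots> \<le> real CARD('v) * rho_alpha \<alpha> k E - \<alpha> * (\<Sum>i\<in>UNIV. real (vertex_degree E i) * w i)"
    using rho by simp
  finally show ?thesis by (simp add: w_def)
qed

section \<open>The test vector built from the degrees on \<open>S\<close>\<close>

theorem theorem4p4:
  fixes E :: "'v::finite set set" and S :: "'v set"
    and k n m s :: nat and \<alpha> :: real
  assumes "k \<ge> 3" and "0 \<le> \<alpha>" and "\<alpha> < 1"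
    and "uniform_hypergraph k E" and "connected_hypergraph E"
    and "CARD('v) = n" and "card E = m"
    and "S \<noteq> {}" and "card S = s"
  shows "rho_alpha \<alpha> k E - real k * real m / real n \<ge>
    1 / (real k * real n) *
      (\<alpha> * (real s *
              ((\<Sum>i\<in>S. real (vertex_degree E i) powr ((2 * real k - 1) / (real k - 1))) /
               (\<Sum>i\<in>S. real (vertex_degree E i) powr (real k / (real k - 1))))
            - (\<Sum>i\<in>S. real (vertex_degree E i)))
       + (1 - \<alpha>) * real k *
           (real s powr (1 / real k) *
              (\<Sum>i\<in>S. real (vertex_degree E i) powr (real k / (real k - 1))) powr ((real k - 1) / real k)
            - (\<Sum>i\<in>S. real (vertex_degree E i))))"
proof -
  define d where "d = (\<lambda>i. real (vertex_degree E i))"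
  define D where "D = (\<Sum>i\<in>S. d i)"
  define T where "T = (\<Sum>i\<in>S. d i powr (real k / (real k - 1)))"
  define R where "R = (\<Sum>i\<in>S. d i powr ((2 * real k - 1) / (real k - 1)))"
  have k: "real k - 1 > 0" using assms(1) by simp
  \<comment> \<open>An edge has \<open>k \<ge> 3\<close> vertices, so there are at least two
    vertices, which makes all degrees positive.\<close>
  have "k \<le> n"
  proof -
    obtain e where "e \<in> E" using assms(4) by (auto simp: uniform_hypergraph_def)
    then have "card e = k" using assms(4) by (auto simp: uniform_hypergraph_def)
    then show ?thesis using card_mono[of UNIV e] assms(6) by simp
  qed
  then have n: "n > 0" "CARD('v) \<ge> 2" using assms(1,6) by auto
  have d: "d i > 0" for i
    using connected_hypergraph_degree_pos[OF assms(5) n(2)] by (simp add: d_def)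
  have s: "real s > 0" using assms(8,9) by (auto simp: card_gt_0_iff)
  have T: "T > 0" unfolding T_def using assms(8) d by (intro sum_pos) (auto simp: less_imp_neq[symmetric])
  \<comment> \<open>Chosen with \<open>c ^ k * T = s\<close>, so that the \<open>k\<close>-th powers
    of the entries on \<open>S\<close> sum to \<open>s\<close>, as if all were 1.\<close>
  define c where "c = (real s / T) powr (1 / real k)"
  \<comment> \<open>The exponent \<open>1 / (k - 1)\<close> is the equality case of Hoelder's
    inequality: for the given sum of \<open>k\<close>-th powers on \<open>S\<close> it maximises the
    sum of \<open>d i * x i\<close> over \<open>S\<close>. The value 1 off \<open>S\<close> leaves
    the degrees there unchanged, and they add up to \<open>k * m - D\<close>.\<close>
  define x where "x = (\<lambda>i. if i \<in> S then c * d i powr (1 / (real k - 1)) else 1)"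
  have split: "(\<Sum>i\<in>UNIV. f i) = (\<Sum>i\<in>S. f i) + (\<Sum>i\<in>-S. f i)" for f :: "'v \<Rightarrow> real"
    by (subst sum.union_disjoint[symmetric]) (auto simp: Compl_partition)
  have km: "D + (\<Sum>i\<in>-S. d i) = real k * real m"
  proof -
    have "(\<Sum>i\<in>UNIV. d i * 1) = (\<Sum>e\<in>E. \<Sum>i\<in>e. 1)"
      unfolding d_def by (rule sum_degree_weighted)
    also have "\<dots> = (\<Sum>e\<in>E. real k)"
      using assms(4) by (intro sum.cong) (auto simp: uniform_hypergraph_def)
    finally show ?thesis using assms(7) split[of d] by (simp add: D_def mult.commute)
  qed
  have ck: "c ^ k = real s / T"
    using s T k by (simp add: c_def powr_power)
  have xk: "x i ^ k = real s / T * d i powr (real k / (real k - 1))" if "i \<in> S" for i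
    using that d[of i] by (simp add: x_def power_mult_distrib ck powr_power)
  have x0: "x i \<ge> 0" for i by (simp add: x_def c_def)
  have xsum: "(\<Sum>i\<in>UNIV. x i ^ k) = real CARD('v)"
  proof -
    have "(\<Sum>i\<in>S. x i ^ k) = real s / T * T"
      unfolding T_def sum_distrib_left by (intro sum.cong) (auto simp: xk T_def)
    moreover have "(\<Sum>i\<in>-S. x i ^ k) = real (card (- S))" by (simp add: x_def)
    moreover have "card S + card (- S) = CARD('v)"
      by (subst card_Un_disjoint[symmetric]) (auto simp: Compl_partition)
    ultimately show ?thesis using T assms(9) split[of "\<lambda>i. x i ^ k"] by auto
  qed
  have dx: "(\<Sum>i\<in>UNIV. d i * x i) = real k * real m - D + real s powr (1 / real k) * T powr ((real k - 1) / real k)"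
  proof -
    have "d i * x i = c * d i powr (real k / (real k - 1))" if "i \<in> S" for i
    proof -
      have "d i * d i powr (1 / (real k - 1)) = d i powr (1 + 1 / (real k - 1))"
        using d[of i] by (simp add: powr_add)
      also have "1 + 1 / (real k - 1) = real k / (real k - 1)"
        using k by (simp add: field_simps)
      finally show ?thesis using that by (simp add: x_def)
    qed
    then have "(\<Sum>i\<in>S. d i * x i) = c * T"
      by (simp add: T_def sum_distrib_left)
    also have "\<dots> = real s powr (1 / real k) * (T powr 1 / T powr (1 / real k))"
      using s T by (simp add: c_def powr_divide)
    also have "T powr 1 / T powr (1 / real k) = T powr (1 - 1 / real k)"
      by (simp only: powr_diff)
    also have "1 - 1 / real k = (real k - 1) / real k" using k by (simp add: field_simps)
    finally have "(\<Sum>i\<in>S. d i * x i) = real s powr (1 / real k) * T powr ((real k - 1) / real k)" .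
    moreover have "(\<Sum>i\<in>-S. d i * x i) = (\<Sum>i\<in>-S. d i)" by (simp add: x_def)
    ultimately show ?thesis using km split[of "\<lambda>i. d i * x i"] by simp
  qed
  have dxk: "(\<Sum>i\<in>UNIV. d i * x i ^ k) = real k * real m - D + real s * (R / T)"
  proof -
    \<comment> \<open>The additional factor \<open>d i\<close> raises the exponent
      \<open>k / (k - 1)\<close> by 1, which turns \<open>T\<close> into \<open>R\<close>.\<close>
    have "d i * x i ^ k = real s / T * d i powr ((2 * real k - 1) / (real k - 1))" if "i \<in> S" for i
    proof -
      have "d i * d i powr (real k / (real k - 1)) = d i powr (1 + real k / (real k - 1))"
        using d[of i] by (simp add: powr_add)
      also have "1 + real k / (real k - 1) = (2 * real k - 1) / (real k - 1)"
        using k by (simp add: field_simps)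
      finally show ?thesis using that by (simp add: xk)
    qed
    then have "(\<Sum>i\<in>S. d i * x i ^ k) = real s / T * R"
      by (simp add: R_def sum_distrib_left)
    moreover have "(\<Sum>i\<in>-S. d i * x i ^ k) = (\<Sum>i\<in>-S. d i)" by (simp add: x_def)
    ultimately show ?thesis using km split[of "\<lambda>i. d i * x i ^ k"] by simp
  qed
  \<comment> \<open>Only one part in \<open>k\<close> of the weight depends on \<open>x\<close>, so
    the deviation from \<open>k * m\<close> is divided by \<open>k\<close>.\<close>
  have dw: "(\<Sum>i\<in>UNIV. d i * ((real k - 1 + x i ^ k) / real k)) =
      real k * real m + (real s * (R / T) - D) / real k"
  proof -
    have "(\<Sum>i\<in>UNIV. d i * ((real k - 1 + x i ^ k) / real k)) =
        (\<Sum>i\<in>UNIV. ((real k - 1) * d i + d i * x i ^ k) / real k)"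
      by (intro sum.cong) (simp_all add: algebra_simps)
    also have "\<dots> = ((real k - 1) * (\<Sum>i\<in>UNIV. d i) + (\<Sum>i\<in>UNIV. d i * x i ^ k)) / real k"
      by (simp only: sum_divide_distrib[symmetric] sum.distrib sum_distrib_left)
    also have "(\<Sum>i\<in>UNIV. d i) = real k * real m"
      using km split[of d] by (simp add: D_def)
    finally show ?thesis using k by (simp add: dxk field_simps)
  qed
  define Q where "Q = real s powr (1 / real k) * T powr ((real k - 1) / real k)"
  have "\<alpha> * (real k * real m + (real s * (R / T) - D) / real k) + (1 - \<alpha>) * (real k * real m - D + Q)
      \<le> real n * rho_alpha \<alpha> k E"
    using rho_alpha_lower_bound[OF _ assms(2-5) x0 xsum] assms(1,6)
    unfolding dw[unfolded d_def] dx[unfolded d_def] Q_def by simp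
  \<comment> \<open>The factor \<open>k\<close> before the second bracket cancels
    \<open>1 / k\<close>; the first bracket keeps the division, which matches
    \<open>dw\<close>.\<close>
  moreover have "1 / real k * (\<alpha> * X + (1 - \<alpha>) * real k * Y) = \<alpha> * (X / real k) + (1 - \<alpha>) * Y" for X Y
    using k by (simp add: distrib_left)
  ultimately have "real k * real m + 1 / real k * (\<alpha> * (real s * (R / T) - D) + (1 - \<alpha>) * real k * (Q - D))
      \<le> real n * rho_alpha \<alpha> k E"
    by (simp only:) (simp only: algebra_simps)
  then have "(real k * real m + 1 / real k * (\<alpha> * (real s * (R / T) - D) + (1 - \<alpha>) * real k * (Q - D))) / real n
      \<le> rho_alpha \<alpha> k E"
    using n(1) by (simp add: divide_le_eq mult.commute)
  then have "1 / (real k * real n) * (\<alpha> * (real s * (R / T) - D) + (1 - \<alpha>) * real k * (Q - D))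
      \<le> rho_alpha \<alpha> k E - real k * real m / real n"
    unfolding add_divide_distrib by simp
  then show ?thesis
    unfolding Q_def R_def T_def D_def d_def by simp
qed

end
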